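(* Among the flat Lie algebras on $\mathfrak g_{3,4}^{\alpha=-1}$ given in the list of the context: (i) the associative ones are exactly $\mathfrak h_{0,7}^{\lambda=-1}$; (ii) the Novikov ones are exactly $\mathfrak h_{0,2}^{\delta=0},\mathfrak h_{0,4}^{\lambda=0},\mathfrak h_{0,9},\mathfrak h_{0,10}$; (iii) the bi-symmetric ones are exactly $\mathfrak h_{0,7}^{\lambda=-1},\mathfrak h_{0,8}$; (iv) the complete ones are exactly $\mathfrak h_{0,4}^{\lambda=0},\mathfrak h_{0,11}$.
   Context: A flat Lie algebra is a real Lie algebra $\mathfrak g$ with a bilinear product $X\cdot Y=\nabla_XY$ such that $X\cdot Y-Y\cdot X=[X,Y]$ and $[X,Y]\cdot Z=X\cdot(Y\cdot Z)-Y\cdot(X\cdot Z)$. Put $R_X(Y)=Y\cdot X$ and $(X,Y,Z)=(X\cdot Y)\cdot Z-X\cdot(Y\cdot Z)$. It is associative if $(X,Y,Z)=0$ for all $X,Y,Z$; Novikov if $R_XR_Y=R_YR_X$ for all $X,Y$; bi-symmetric if $(X,Y,Z)=(X,Z,Y)$ for all $X,Y,Z$; complete if every $R_X$ is nilpotent. A superscript restricts the indicated parameter to the indicated value; parameters not mentioned take all admissible values. List on the Lie algebra $\mathfrak g_{3,4}^{\alpha=-1}$ with basis $e_1,e_2,e_3$ and nonzero brackets $[e_1,e_3]=e_1$, $[e_2,e_3]=-e_2$ (only nonzero products $e_ie_j=e_i\cdot e_j$ given; $\delta,\delta_1,\delta_2\in\{0,1\}$, $\varepsilon=\pm1$): $\mathfrak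 h_{0,1}$: $e_2e_3=\delta e_1,\ e_3e_1=-e_1,\ e_3e_2=\delta e_1+e_2,\ e_3e_3=-2e_3$. $\mathfrak h_{0,2}$: $e_1e_3=2e_1,\ e_2e_3=\delta e_1+2e_2,\ e_3e_1=e_1,\ e_3e_2=\delta e_1+3e_2,\ e_3e_3=2e_3$. $\mathfrak h_{0,3}$: $e_1e_1=\varepsilon e_3,\ e_3e_1=-e_1,\ e_3e_2=e_2,\ e_3e_3=-2e_3$. $\mathfrak h_{0,4}$: $e_3e_1=-e_1,\ e_3e_2=e_2,\ e_3e_3=\lambda e_3$; $\lambda\in\mathbb R$, $\lambda\neq\pm2$. $\mathfrak h_{0,5}$: $e_3e_1=-e_1,\ e_3e_2=e_2,\ e_3e_3=e_1-e_3$. $\mathfrak h_{0,6}$: $e_3e_1=-e_1,\ e_3e_2=e_2,\ e_3e_3=e_2+e_3$. $\mathfrak h_{0,7}$: $e_2e_3=\lambda e_2,\ e_3e_1=-e_1,\ e_3e_2=(1+\lambda)e_2,\ e_3e_3=\lambda e_3$; $\lambda\in\mathbb R\setminus\{0\}$. $\mathfrak h_{0,8}$: $e_2e_3=-e_2,\ e_3e_1=-e_1,\ e_3e_3=\delta_1e_1+\delta_2e_2-e_3$; $\delta_1^2+\delta_2^2\neq0$. $\mathfrak h_{0,9}$: $e_1e_3=\lambda e_1,\ e_2e_3=\lambda e_2,\ e_3e_1=(\lambda-1)e_1,\ e_3e_2=(1+\lambda)e_2,\ e_3e_3=\lambda e_3$; $\lambda\in\mathbb R\setminus\{0\}$, $\lambda\neq\pm2$.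 $\mathfrak h_{0,10}$: $e_1e_3=e_1,\ e_2e_3=e_2,\ e_3e_2=2e_2,\ e_3e_3=e_1+e_3$. $\mathfrak h_{0,11}$: $e_1e_2=e_3,\ e_2e_1=e_3,\ e_3e_1=-e_1,\ e_3e_2=e_2$. $\mathfrak h_{2,1}$: $e_1e_3=3e_1,\ e_2e_2=e_1,\ e_3e_1=2e_1,\ e_3e_2=e_2,\ e_3e_3=3e_3$. $\mathfrak h_{2,2}$: $e_2e_2=e_1,\ e_2e_3=-3e_2,\ e_3e_1=-e_1,\ e_3e_2=-2e_2,\ e_3e_3=-3e_3$. *)

theory Defs
  imports "HOL-Analysis.Analysis"
begin

definition lie_bracket :: "('a::real_vector \<Rightarrow> 'a \<Rightarrow> 'a) \<Rightarrow> bool" where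
  "lie_bracket br \<longleftrightarrow>
     bilinear br \<and> (\<forall>X. br X X = 0) \<and>
     (\<forall>X Y Z. br X (br Y Z) + br Y (br Z X) + br Z (br X Y) = 0)"

definition flat_lie_algebra ::
    "('a::real_vector \<Rightarrow> 'a \<Rightarrow> 'a) \<Rightarrow> ('a \<Rightarrow> 'a \<Rightarrow> 'a) \<Rightarrow> bool" where
  "flat_lie_algebra br p \<longleftrightarrow>
     lie_bracket br \<and> bilinear p \<and>
     (\<forall>X Y. p X Y - p Y X = br X Y) \<and>
     (\<forall>X Y Z. p (br X Y) Z = p X (p Y Z) - p Y (p X Z))"

definition right_mult :: "('a \<Rightarrow> 'a \<Rightarrow> 'a) \<Rightarrow> 'a \<Rightarrow> 'a \<Rightarrow> 'a" where
  "right_mult p X = (\<lambda>Y. p Y X)"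

definition associator :: "('a::real_vector \<Rightarrow> 'a \<Rightarrow> 'a) \<Rightarrow> 'a \<Rightarrow> 'a \<Rightarrow> 'a \<Rightarrow> 'a" where
  "associator p X Y Z = p (p X Y) Z - p X (p Y Z)"

definition nilpotent_map :: "('a::real_vector \<Rightarrow> 'a) \<Rightarrow> bool" where
  "nilpotent_map f \<longleftrightarrow> (\<exists>n. f ^^ n = (\<lambda>_. 0))"

definition associative_alg :: "('a::real_vector \<Rightarrow> 'a \<Rightarrow> 'a) \<Rightarrow> bool" where
  "associative_alg p \<longleftrightarrow> (\<forall>X Y Z. associator p X Y Z = 0)"

definition novikov_alg :: "('a::real_vector \<Rightarrow> 'a \<Rightarrow> 'a) \<Rightarrow> bool" where
  "novikov_alg p \<longleftrightarrow>
     (\<forall>X Y. right_mult p X \<circ> right_mult p Y = right_mult p Y \<circ> right_mult p X)"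

definition bisymmetric_alg :: "('a::real_vector \<Rightarrow> 'a \<Rightarrow> 'a) \<Rightarrow> bool" where
  "bisymmetric_alg p \<longleftrightarrow> (\<forall>X Y Z. associator p X Y Z = associator p X Z Y)"

definition complete_alg :: "('a::real_vector \<Rightarrow> 'a \<Rightarrow> 'a) \<Rightarrow> bool" where
  "complete_alg p \<longleftrightarrow> (\<forall>X. nilpotent_map (right_mult p X))"

abbreviation e1 :: "real ^ 3" where "e1 \<equiv> axis 1 1"
abbreviation e2 :: "real ^ 3" where "e2 \<equiv> axis 2 1"
abbreviation e3 :: "real ^ 3" where "e3 \<equiv> axis 3 1"

text \<open>A triple (i, j, v) in the table stands for the product of the basis vectors number
  i and j being v; a pair of indices that does not occur has product 0.\<close>

definition table_product ::
    "(3 \<times> 3 \<times> (real ^ 3)) list \<Rightarrow> real ^ 3 \<Rightarrow> real ^ 3 \<Rightarrow> real ^ 3" where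
  "table_product T X Y = (\<Sum>(i, j, v)\<leftarrow>T. (X $ i * Y $ j) *\<^sub>R v)"

definition bracket_g34 :: "real ^ 3 \<Rightarrow> real ^ 3 \<Rightarrow> real ^ 3" where
  "bracket_g34 = table_product [(1, 3, e1), (3, 1, - e1), (2, 3, - e2), (3, 2, e2)]"

text \<open>The arguments are the parameters of the families: \<open>\<delta>\<close> for \<open>H01\<close> and \<open>H02\<close>,
  \<open>\<epsilon>\<close> for \<open>H03\<close>, \<open>\<lambda>\<close> for \<open>H04\<close>, \<open>H07\<close> and \<open>H09\<close>, and \<open>\<delta>\<^sub>1\<close>, \<open>\<delta>\<^sub>2\<close> for \<open>H08\<close>;
  their ranges are imposed by \<open>admissible\<close>.\<close>

datatype flat_alg =
    H01 real | H02 real | H03 real | H04 real | H05 | H06 | H07 real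
  | H08 real real | H09 real | H010 | H011 | H21 | H22

fun admissible :: "flat_alg \<Rightarrow> bool" where
  "admissible (H01 d) \<longleftrightarrow> d \<in> {0, 1}"
| "admissible (H02 d) \<longleftrightarrow> d \<in> {0, 1}"
| "admissible (H03 e) \<longleftrightarrow> e \<in> {1, - 1}"
| "admissible (H04 l) \<longleftrightarrow> l \<noteq> 2 \<and> l \<noteq> - 2"
| "admissible H05 \<longleftrightarrow> True"
| "admissible H06 \<longleftrightarrow> True"
| "admissible (H07 l) \<longleftrightarrow> l \<noteq> 0"
| "admissible (H08 d1 d2) \<longleftrightarrow> d1 \<in> {0, 1} \<and> d2 \<in> {0, 1} \<and> d1\<^sup>2 + d2\<^sup>2 \<noteq> 0"
| "admissible (H09 l) \<longleftrightarrow> l \<noteq> 0 \<and> l \<noteq> 2 \<and> l \<noteq> - 2"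
| "admissible H010 \<longleftrightarrow> True"
| "admissible H011 \<longleftrightarrow> True"
| "admissible H21 \<longleftrightarrow> True"
| "admissible H22 \<longleftrightarrow> True"

fun table :: "flat_alg \<Rightarrow> (3 \<times> 3 \<times> (real ^ 3)) list" where
  "table (H01 d) =
     [(2, 3, d *\<^sub>R e1), (3, 1, - e1), (3, 2, d *\<^sub>R e1 + e2), (3, 3, - 2 *\<^sub>R e3)]"
| "table (H02 d) =
     [(1, 3, 2 *\<^sub>R e1), (2, 3, d *\<^sub>R e1 + 2 *\<^sub>R e2), (3, 1, e1),
      (3, 2, d *\<^sub>R e1 + 3 *\<^sub>R e2), (3, 3, 2 *\<^sub>R e3)]"
| "table (H03 e) = [(1, 1, e *\<^sub>R e3), (3, 1, - e1), (3, 2, e2), (3, 3, - 2 *\<^sub>R e3)]"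
| "table (H04 l) = [(3, 1, - e1), (3, 2, e2), (3, 3, l *\<^sub>R e3)]"
| "table H05 = [(3, 1, - e1), (3, 2, e2), (3, 3, e1 - e3)]"
| "table H06 = [(3, 1, - e1), (3, 2, e2), (3, 3, e2 + e3)]"
| "table (H07 l) =
     [(2, 3, l *\<^sub>R e2), (3, 1, - e1), (3, 2, (1 + l) *\<^sub>R e2), (3, 3, l *\<^sub>R e3)]"
| "table (H08 d1 d2) =
     [(2, 3, - e2), (3, 1, - e1), (3, 3, d1 *\<^sub>R e1 + d2 *\<^sub>R e2 - e3)]"
| "table (H09 l) =
     [(1, 3, l *\<^sub>R e1), (2, 3, l *\<^sub>R e2), (3, 1, (l - 1) *\<^sub>R e1),
      (3, 2, (1 + l) *\<^sub>R e2), (3, 3, l *\<^sub>R e3)]"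
| "table H010 = [(1, 3, e1), (2, 3, e2), (3, 2, 2 *\<^sub>R e2), (3, 3, e1 + e3)]"
| "table H011 = [(1, 2, e3), (2, 1, e3), (3, 1, - e1), (3, 2, e2)]"
| "table H21 =
     [(1, 3, 3 *\<^sub>R e1), (2, 2, e1), (3, 1, 2 *\<^sub>R e1), (3, 2, e2), (3, 3, 3 *\<^sub>R e3)]"
| "table H22 =
     [(2, 2, e1), (2, 3, - 3 *\<^sub>R e2), (3, 1, - e1), (3, 2, - 2 *\<^sub>R e2), (3, 3, - 3 *\<^sub>R e3)]"

definition flat_product :: "flat_alg \<Rightarrow> real ^ 3 \<Rightarrow> real ^ 3 \<Rightarrow> real ^ 3" where
  "flat_product h = table_product (table h)"

definition flat_list :: "flat_alg set" where
  "flat_list = {h. admissible h}"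

lemma axis_three_simps:
  "axis k (1::real) $ i = (if i = k then 1 else 0)" for i k :: 3
  by (simp add: axis_def)

lemma bilinear_table_product: "bilinear (table_product T)"
proof (induction T)
  case Nil
  then show ?case by (simp add: table_product_def bilinear_def linear_iff)
next
  case (Cons t T)
  obtain i j v where t: "t = (i, j, v)" by (cases t)
  have "table_product (t # T) X Y = (X $ i * Y $ j) *\<^sub>R v + table_product T X Y" for X Y
    by (simp add: table_product_def t)
  with Cons show ?case
    by (auto simp: bilinear_def linear_iff algebra_simps)
qed

lemma lie_bracket_g34: "lie_bracket bracket_g34"
  unfolding lie_bracket_def
proof (intro conjI allI)
  show "bilinear bracket_g34"
    by (simp add: bracket_g34_def bilinear_table_product)
qed (simp_all add: bracket_g34_def table_product_def vec_eq_iff forall_3 axis_three_simps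
       algebra_simps)

lemma flat_list_flat_lie_algebra:
  assumes "h \<in> flat_list"
  shows "flat_lie_algebra bracket_g34 (flat_product h)"
  unfolding flat_lie_algebra_def
proof (intro conjI allI)
  show "lie_bracket bracket_g34" by (rule lie_bracket_g34)
  show "bilinear (flat_product h)" by (simp add: flat_product_def bilinear_table_product)
  show "flat_product h X Y - flat_product h Y X = bracket_g34 X Y" for X Y
    by (cases h) (simp_all add: flat_product_def bracket_g34_def table_product_def vec_eq_iff
      forall_3 axis_three_simps algebra_simps)
  show "flat_product h (bracket_g34 X Y) Z =
      flat_product h X (flat_product h Y Z) - flat_product h Y (flat_product h X Z)" for X Y Z
    by (cases h) (simp_all add: flat_product_def bracket_g34_def table_product_def vec_eq_iff
      forall_3 axis_three_simps algebra_simps)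
qed

end

theory Submission
  imports Defs
begin

text \<open>Associativity, bi-symmetry and commutation of the right multiplications are polynomial
  identities in the coordinates; when one of them fails, it fails on few basis triples.
  Associativity implies bi-symmetry, so only \<open>H07 (- 1)\<close> and \<open>H08\<close> are left to test for it.
  Completeness always fails through an eigenvector of the right multiplication by \<open>e3\<close>
  with nonzero eigenvalue, and where it holds every right multiplication has cube zero.\<close>

lemmas product_simps =
  flat_product_def table_product_def vec_eq_iff forall_3 axis_three_simps

lemma associative_imp_bisymmetric: "associative_alg p \<Longrightarrow> bisymmetric_alg p"
  by (simp add: associative_alg_def bisymmetric_alg_def)

lemma novikov_alg_iff: "novikov_alg p \<longleftrightarrow> (\<forall>X Y Z. p (p Z Y) X = p (p Z X) Y)"
  by (auto simp: novikov_alg_def right_mult_def fun_eq_iff)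

lemma bisymmetric_flat_product_iff:
  assumes "h \<in> flat_list"
  shows "bisymmetric_alg (flat_product h) \<longleftrightarrow> h = H07 (- 1) \<or> (\<exists>d1 d2. h = H08 d1 d2)"
proof
  let ?a = "associator (flat_product h)"
  assume "bisymmetric_alg (flat_product h)"
  \<comment> \<open>If \<open>e3\<close> acts on \<open>e1\<close> or \<open>e2\<close> from both
    sides by scalars, from the left by m, and e3e3 = c e3, the first two equations say m (c - m) =
    0. This excludes \<open>H04\<close> and \<open>H09\<close> and leaves -1 in
    \<open>H07\<close>.\<close>
  then have "?a e3 e1 e3 = ?a e3 e3 e1" "?a e3 e2 e3 = ?a e3 e3 e2"
    "?a e1 e1 e2 = ?a e1 e2 e1" "?a e2 e2 e3 = ?a e2 e3 e2"
    by (auto simp: bisymmetric_alg_def)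
  then show "h = H07 (- 1) \<or> (\<exists>d1 d2. h = H08 d1 d2)"
    using assms
    by (cases h) (auto simp: flat_list_def associator_def product_simps algebra_simps)
next
  assume "h = H07 (- 1) \<or> (\<exists>d1 d2. h = H08 d1 d2)"
  then show "bisymmetric_alg (flat_product h)"
    by (auto simp: bisymmetric_alg_def associator_def product_simps algebra_simps)
qed

lemma associative_flat_product_iff:
  assumes "h \<in> flat_list"
  shows "associative_alg (flat_product h) \<longleftrightarrow> h = H07 (- 1)"
proof
  assume assoc: "associative_alg (flat_product h)"
  \<comment> \<open>For \<open>H08 d1 d2\<close> this is
    \<open>d1 *\<^sub>R e1 - d2 *\<^sub>R e2\<close>, nonzero by admissibility.\<close>
  then have "associator (flat_product h) e3 e3 e3 = 0"
    by (simp add: associative_alg_def)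
  then show "h = H07 (- 1)"
    using assms assoc[THEN associative_imp_bisymmetric] bisymmetric_flat_product_iff[OF assms]
    by (auto simp: flat_list_def associator_def product_simps)
next
  assume "h = H07 (- 1)"
  then show "associative_alg (flat_product h)"
    by (simp add: associative_alg_def associator_def product_simps algebra_simps)
qed

lemma novikov_flat_product_iff:
  assumes "h \<in> flat_list"
  shows "novikov_alg (flat_product h) \<longleftrightarrow> h = H02 0 \<or> h = H04 0 \<or> (\<exists>l. h = H09 l) \<or> h = H010"
proof
  let ?p = "flat_product h"
  assume "novikov_alg ?p"
  \<comment> \<open>The equation in \<open>e3\<close>, \<open>e2\<close> forces parameter 0 in
    \<open>H02\<close>, the one in \<open>e3\<close>, \<open>e1\<close> does so in
    \<open>H04\<close>; only the triple \<open>e1\<close>, \<open>e1\<close>, \<open>e2\<close>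
    excludes \<open>H011\<close>.\<close>
  then have "?p (?p e3 e1) e3 = ?p (?p e3 e3) e1" "?p (?p e3 e2) e3 = ?p (?p e3 e3) e2"
    "?p (?p e1 e1) e2 = ?p (?p e1 e2) e1" "?p (?p e2 e2) e3 = ?p (?p e2 e3) e2"
    by (simp_all add: novikov_alg_iff)
  then show "h = H02 0 \<or> h = H04 0 \<or> (\<exists>l. h = H09 l) \<or> h = H010"
    using assms
    by (cases h) (auto simp: flat_list_def product_simps algebra_simps)
next
  assume "h = H02 0 \<or> h = H04 0 \<or> (\<exists>l. h = H09 l) \<or> h = H010"
  then show "novikov_alg (flat_product h)"
    by (auto simp: novikov_alg_iff product_simps algebra_simps)
qed

lemma not_nilpotent_if_eigenvector:
  fixes f :: "'a::real_vector \<Rightarrow> 'a"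
  assumes "linear f" and eigen: "f v = c *\<^sub>R v" and "c \<noteq> 0" "v \<noteq> 0"
  shows "\<not> nilpotent_map f"
proof -
  have "(f ^^ n) v = c ^ n *\<^sub>R v" for n
    by (induction n) (simp_all add: eigen linear_scale[OF \<open>linear f\<close>] mult.commute)
  with \<open>c \<noteq> 0\<close> \<open>v \<noteq> 0\<close> show ?thesis
    by (auto simp: nilpotent_map_def fun_eq_iff) (metis power_not_zero scaleR_eq_0_iff)
qed

lemma linear_right_mult: "bilinear p \<Longrightarrow> linear (right_mult p X)"
  by (simp add: bilinear_def right_mult_def)

lemma complete_flat_product_iff:
  assumes "h \<in> flat_list"
  shows "complete_alg (flat_product h) \<longleftrightarrow> h = H04 0 \<or> h = H011"
proof
  let ?R = "right_mult (flat_product h) e3"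
  assume "complete_alg (flat_product h)"
  moreover have "linear ?R"
    by (simp add: linear_right_mult flat_product_def bilinear_table_product)
  ultimately have no_eigen: "?R v = c *\<^sub>R v \<Longrightarrow> c = 0 \<or> v = 0" for c v
    using not_nilpotent_if_eigenvector complete_alg_def by metis
  show "h = H04 0 \<or> h = H011"
    \<comment> \<open>The entry \<open>$ 3\<close> is the eigenvalue whenever e3e3 is a multiple of
      \<open>e3\<close>; the other vectors serve \<open>H05\<close>, \<open>H06\<close>,
      \<open>H08\<close> and \<open>H010\<close>, in this order.\<close>
    using assms no_eigen[of e3 "flat_product h e3 e3 $ 3"] no_eigen[of "e1 - e3" "- 1"]
      no_eigen[of "e2 + e3" 1] no_eigen[of e2 "- 1"] no_eigen[of e1 1]
    by (cases h) (simp_all add: flat_list_def right_mult_def product_simps)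
next
  assume h: "h = H04 0 \<or> h = H011"
  \<comment> \<open>In \<open>H011\<close> the map sends \<open>e1\<close> and \<open>e2\<close> to
    multiples of \<open>e3\<close>, and \<open>e3\<close> to a vector w = -x1 e1 + x2 e2 that it
    kills, since -x1 x2 + x2 x1 = 0.\<close>
  have "(right_mult (flat_product h) X ^^ 3) Y = 0" for X Y
    using h by (auto simp: right_mult_def product_simps eval_nat_numeral algebra_simps)
  then show "complete_alg (flat_product h)"
    unfolding complete_alg_def nilpotent_map_def by blast
qed

theorem corollary6:
  shows "{h \<in> flat_list. associative_alg (flat_product h)} = {H07 (- 1)} \<and>
         {h \<in> flat_list. novikov_alg (flat_product h)} =
           {H02 0, H04 0} \<union> {H09 l |l. H09 l \<in> flat_list} \<union> {H010} \<and>
         {h \<in> flat_list. bisymmetric_alg (flat_product h)} =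
           {H07 (- 1)} \<union> {H08 d1 d2 |d1 d2. H08 d1 d2 \<in> flat_list} \<and>
         {h \<in> flat_list. complete_alg (flat_product h)} = {H04 0, H011}"
proof -
  \<comment> \<open>The algebras listed singly need this check; the sets for \<open>H08\<close> and
    \<open>H09\<close> carry membership themselves.\<close>
  have "H07 (- 1) \<in> flat_list" "H02 0 \<in> flat_list" "H04 0 \<in> flat_list"
    "H010 \<in> flat_list" "H011 \<in> flat_list"
    by (simp_all add: flat_list_def)
  then show ?thesis
    using associative_flat_product_iff novikov_flat_product_iff bisymmetric_flat_product_iff
      complete_flat_product_iff
    by (intro conjI set_eqI) (auto 0 3)
qed

end
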